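(* Let $f=x\oplus y\oplus z\oplus 0$ and let $g=\bigoplus_{a+b+c\le m}\alpha_{abc}x^ay^bz^c$ be a tropical polynomial with $\mathrm{Newt}(g)=\mathrm{Conv}(\{(0,0,0),(m,0,0),(0,m,0),(0,0,m)\})$ such that $C=\mathbf{V}(f)\cap\mathbf{V}(g)$ is a smooth tropical complete intersection curve. Let $K$ be the dual subdivision of $\Delta_m$ given by $g|_{z=0}$, with marked cells as defined in the context. Then each face of a marked cell of $K$ is marked, and the union of all marked cells is connected.
   Context: Tropical operations: $x\oplus y=\max(x,y)$, $x\odot y=x+y$ on $\mathbb{R}\cup\{-\infty\}$. For a tropical polynomial $p=\bigoplus_i\alpha_i x^{a_i}\ne-\infty$ in $n$ variables (absent monomials have coefficient $-\infty$), $\mathbf{V}(p)\subset\mathbb{R}^n$ is the set of points $t$ where the maximum of the values $\alpha_i+a_i\cdot t$ is attained by at least two terms; $\mathrm{Newt}(p)$ is the convex hull of the exponents with finite coefficient. A domain of $\mathbb{R}^n\setminus\mathbf{V}(p)$ is a connected component. Smooth complete intersection: for tropical polynomials $p,q$ in three variables with terms $\alpha_i x^{a_i}y^{b_i}z^{c_i}$, $\beta_j x^{a'_j}y^{b'_j}z^{c'_j}$ and $P=\mathrm{Newt}(p)$, $Q=\mathrm{Newt}(q)$, the Cayley subdivision of $\mathrm{Cay}(P,Q)=\mathrm{Conv}((P\times\{0\})\cup(Q\times\{1\}))\subset\mathbb{R}^4$ consists of the projections of the bounded faces of $\mathrm{Conv}(\{(a_i,b_i,c_i,0,\alpha)\mid\alpha\le\alpha_i\}\cup\{(a'_j,b'_j,c'_j,1,\beta)\mid\beta\le\beta_j\})\subset\mathbb{R}^5$.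 $\mathbf{V}(p)\cap\mathbf{V}(q)$ is a smooth complete intersection curve if all $4$-dimensional cells of this subdivision have volume $1/24$. Let $g|_{z=0}=\bigoplus_{a+b\le m}\alpha_{ab}x^ay^b$ with $\alpha_{ab}=\max(\alpha_{ab0},\dots,\alpha_{a,b,m-a-b})$. Its Newton polygon is $\Delta_m=\mathrm{Conv}(\{(0,0),(m,0),(0,m)\})$. $K$ is the polyhedral complex of projections to $\mathbb{R}^2$ of the bounded faces of $\mathrm{Conv}(\{(a,b,\alpha)\mid\alpha\le\alpha_{ab}\})$. Let $\tilde K$ be the polyhedral complex consisting of the vertices and edges of $\mathbf{V}(g|_{z=0})$ and the closures of the domains of $\mathbb{R}^2\setminus\mathbf{V}(g|_{z=0})$; it is dual to $K$: a cell $Q$ of $K$ corresponds to the cell of $\tilde K$ of points where all the terms of $g|_{z=0}$ with exponent a vertex of $Q$ attain the maximum. A cell of $K$ is marked if the corresponding cell of $\tilde K$ intersects $\mathbb{R}^2_{\le0}$. *)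

theory Defs
  imports "HOL-Analysis.Analysis"
begin

text \<open>
  A tropical polynomial in the variables indexed by \<open>'n\<close> is given by its coefficient function,
  an absent monomial having coefficient \<open>-\<infinity>\<close>.  Coefficients lie in \<open>\<real> \<union> {-\<infinity>}\<close>, whereas
  \<^typ>\<open>ereal\<close> also contains \<open>\<infinity>\<close>, which \<open>is_trop_poly\<close> rules out.
\<close>

type_synonym 'n trop_poly = "nat ^ 'n \<Rightarrow> ereal"

definition trop_supp :: "'n::finite trop_poly \<Rightarrow> (nat ^ 'n) set" where
  "trop_supp p = {a. p a \<noteq> -\<infinity>}"

definition is_trop_poly :: "'n::finite trop_poly \<Rightarrow> bool" where
  "is_trop_poly p \<longleftrightarrow> finite (trop_supp p) \<and> (\<forall>a. p a \<noteq> \<infinity>)"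

definition real_vec :: "nat ^ 'n::finite \<Rightarrow> real ^ 'n" where
  "real_vec a = (\<chi> i. real (a $ i))"

definition newton_polytope :: "'n::finite trop_poly \<Rightarrow> (real ^ 'n) set" where
  "newton_polytope p = convex hull (real_vec ` trop_supp p)"

definition trop_term :: "'n::finite trop_poly \<Rightarrow> nat ^ 'n \<Rightarrow> real ^ 'n \<Rightarrow> ereal" where
  "trop_term p a t = p a + ereal (real_vec a \<bullet> t)"

definition attains_max :: "'n::finite trop_poly \<Rightarrow> real ^ 'n \<Rightarrow> nat ^ 'n \<Rightarrow> bool" where
  "attains_max p t a \<longleftrightarrow>
     a \<in> trop_supp p \<and> (\<forall>b\<in>trop_supp p. trop_term p b t \<le> trop_term p a t)"

definition trop_hypersurface :: "'n::finite trop_poly \<Rightarrow> (real ^ 'n) set" where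
  "trop_hypersurface p = {t. \<exists>a b. a \<noteq> b \<and> attains_max p t a \<and> attains_max p t b}"

text \<open>
  Projections of the nonempty bounded faces of the convex hull of a set \<open>S\<close> of lifted points;
  the last coordinate is the height.
\<close>

definition induced_subdivision :: "('v::euclidean_space \<times> real) set \<Rightarrow> 'v set set" where
  "induced_subdivision S = {fst ` F | F. F face_of (convex hull S) \<and> bounded F \<and> F \<noteq> {}}"

definition dual_subdivision :: "'n::finite trop_poly \<Rightarrow> (real ^ 'n) set set" where
  "dual_subdivision p =
     induced_subdivision {(real_vec a, \<alpha>) | a \<alpha>. ereal \<alpha> \<le> p a}"

definition cayley_subdivision ::
    "'n::finite trop_poly \<Rightarrow> 'n trop_poly \<Rightarrow> ((real ^ 'n) \<times> real) set set" where
  "cayley_subdivision p q =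
     induced_subdivision
       ({((real_vec a, 0), \<alpha>) | a \<alpha>. ereal \<alpha> \<le> p a} \<union>
        {((real_vec b, 1), \<beta>) | b \<beta>. ereal \<beta> \<le> q b})"

text \<open>Smoothness of \<open>C\<close> depends on the defining polynomials, not only on the set \<open>C\<close>.\<close>

definition smooth_complete_intersection_curve ::
    "3 trop_poly \<Rightarrow> 3 trop_poly \<Rightarrow> (real ^ 3) set \<Rightarrow> bool" where
  "smooth_complete_intersection_curve p q C \<longleftrightarrow>
     C = trop_hypersurface p \<inter> trop_hypersurface q \<and>
     (\<forall>D\<in>cayley_subdivision p q. aff_dim D = 4 \<longrightarrow> measure lebesgue D = 1 / 24)"

text \<open>The tropical polynomial \<open>x \<oplus> y \<oplus> z \<oplus> 0\<close>.\<close>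

definition trop_plane :: "3 trop_poly" where
  "trop_plane a = (if a \<in> {axis 1 1, axis 2 1, axis 3 1, 0} then 0 else -\<infinity>)"

text \<open>The restriction \<open>g|\<^bsub>z=0\<^esub>\<close> of a tropical polynomial \<open>g\<close> of degree at most \<open>m\<close>.\<close>

definition restrict_z0 :: "nat \<Rightarrow> 3 trop_poly \<Rightarrow> 2 trop_poly" where
  "restrict_z0 m g a =
     (if a $ 1 + a $ 2 \<le> m
      then Max ((\<lambda>c. g (vector [a $ 1, a $ 2, c])) ` {0..m - a $ 1 - a $ 2})
      else -\<infinity>)"

text \<open>
  For a cell \<open>Q\<close> of \<open>dual_subdivision p\<close>, the corresponding cell of the dual complex, whose cells
  are those of the hypersurface of \<open>p\<close> and the closures of the domains of its complement.
\<close>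

definition dual_cell :: "'n::finite trop_poly \<Rightarrow> (real ^ 'n) set \<Rightarrow> (real ^ 'n) set" where
  "dual_cell p Q = {t. \<forall>a. real_vec a extreme_point_of Q \<longrightarrow> attains_max p t a}"

definition marked_cell :: "2 trop_poly \<Rightarrow> (real ^ 2) set \<Rightarrow> bool" where
  "marked_cell p Q \<longleftrightarrow>
     Q \<in> dual_subdivision p \<and> dual_cell p Q \<inter> {t. t $ 1 \<le> 0 \<and> t $ 2 \<le> 0} \<noteq> {}"

end

theory Submission imports Defs begin

text \<open>
  For every point \<open>t\<close>, the convex hull \<open>Q\<^sub>t\<close> of the exponents attaining the maximum at \<open>t\<close> is a
  cell of the dual subdivision, and a cell is marked iff it lies in \<open>Q\<^sub>t\<close> for some \<open>t\<close> in the
  negative quadrant \<open>R\<close>.  So the union of the marked cells is the union of the connected sets \<open>Q\<^sub>t\<close>,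
  \<open>t \<in> R\<close>.  A separation of this union would sort the exponents into two classes, and so split \<open>R\<close>
  into two disjoint closed sets, as each exponent attains the maximum on a closed set; but \<open>R\<close> is
  convex.
\<close>

section \<open>Faces of convex hulls and of projected cells\<close>

lemma face_of_linear_vimage:
  assumes "linear f" and "F face_of f ` G" and "convex G"
  shows "{x \<in> G. f x \<in> F} face_of G"
proof -
  have "{x \<in> G. f x \<in> F} = G \<inter> f -` F" by auto
  moreover have "convex (f -` F)"
    using assms(1,2) by (simp add: convex_linear_vimage face_of_imp_convex)
  ultimately have "convex {x \<in> G. f x \<in> F}" using assms(3) by (simp add: convex_Int)
  moreover have "f a \<in> F \<and> f b \<in> F"
    if "a \<in> G" "b \<in> G" "x \<in> G" "f x \<in> F" and x: "x \<in> open_segment a b" for a b x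
  proof (cases "f a = f b")
    \<comment> \<open>If \<open>f\<close> collapses the segment, the open segment between the images
      is empty and the face property says nothing; but then \<open>f x\<close> is the common image
      of the end points.\<close>
    case True
    obtain u where "x = (1 - u) *\<^sub>R a + u *\<^sub>R b"
      using x by (auto simp: in_segment)
    then have "f x = (1 - u) *\<^sub>R f a + u *\<^sub>R f b"
      using assms(1) by (simp add: linear_add linear_scale)
    then have "f x = f a" using True by (simp flip: scaleR_add_left)
    then show ?thesis using True that(4) by simp
  next
    case False
    then have "f x \<in> open_segment (f a) (f b)"
      using x assms(1) by (auto simp: in_segment linear_add linear_scale)
    then show ?thesis using that assms(2) unfolding face_of_def by blast
  qed
  ultimately show ?thesis unfolding face_of_def by blast
qed

text \<open>The points of the hull that are either outside \<open>F\<close> or in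
  \<open>convex hull (F \<inter> S)\<close> form a convex set containing \<open>S\<close>: a proper
  convex combination lying in a face forces both end points into that face. The argument covers
  infinite \<open>S\<close>, such as the vertical rays of lifted exponents.\<close>

lemma face_of_convex_hull_eq:
  assumes "F face_of (convex hull S)"
  shows "F = convex hull (F \<inter> S)"
proof
  have cF: "convex F" using assms by (rule face_of_imp_convex)
  then show "convex hull (F \<inter> S) \<subseteq> F" by (simp add: hull_minimal)
  let ?D = "{x \<in> convex hull S. x \<in> F \<longrightarrow> x \<in> convex hull (F \<inter> S)}"
  have "convex ?D"
  proof (rule convexI, clarsimp, intro conjI impI)
    fix x y and u v :: real
    assume xy: "x \<in> convex hull S" "x \<in> F \<longrightarrow> x \<in> convex hull (F \<inter> S)"
      "y \<in> convex hull S" "y \<in> F \<longrightarrow> y \<in> convex hull (F \<inter> S)"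
      and uv: "0 \<le> u" "0 \<le> v" "u + v = 1"
    let ?z = "u *\<^sub>R x + v *\<^sub>R y"
    show "?z \<in> convex hull S" using xy uv by (intro convexD) auto
    assume z: "?z \<in> F"
    show "?z \<in> convex hull (F \<inter> S)"
    proof (cases "x = y \<or> u = 0 \<or> v = 0")
      case True
      then show ?thesis using xy uv z by (auto simp flip: scaleR_add_left)
    next
      case False
      then have "?z \<in> open_segment x y"
        using uv by (auto simp: in_segment intro!: exI[of _ v])
      then have "x \<in> F" "y \<in> F" using assms z xy unfolding face_of_def by blast+
      then show ?thesis using xy uv by (intro convexD) auto
    qed
  qed
  moreover have "S \<subseteq> ?D" by (auto simp: hull_inc)
  ultimately have "convex hull S \<subseteq> ?D" by (simp add: hull_minimal)
  then show "F \<subseteq> convex hull (F \<inter> S)" using face_of_imp_subset[OF assms] by blast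
qed

text \<open>The part of the bounded lifted face \<open>G\<close> that lies over \<open>F\<close> is
  a face of \<open>G\<close>, hence a bounded face of the whole hull, and it projects onto
  \<open>F\<close>.\<close>

lemma induced_subdivision_face:
  assumes "Q \<in> induced_subdivision S" and "F face_of Q" and "F \<noteq> {}"
  shows "F \<in> induced_subdivision S"
proof -
  obtain G where G: "Q = fst ` G" "G face_of (convex hull S)" "bounded G"
    using assms(1) unfolding induced_subdivision_def by blast
  let ?H = "{x \<in> G. fst x \<in> F}"
  have "?H face_of G"
    using assms(2) G by (intro face_of_linear_vimage linear_fst) (auto simp: face_of_imp_convex)
  then have "?H face_of (convex hull S)" using G(2) face_of_trans by blast
  moreover have "bounded ?H" using G(3) by (rule bounded_subset) auto
  moreover have "fst ` ?H = F" using face_of_imp_subset[OF assms(2)] G(1) by auto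
  ultimately show ?thesis using assms(3) unfolding induced_subdivision_def by blast
qed

text \<open>Extreme points of a face are extreme points of \<open>Q\<close>, so passing to the face
  only drops conditions.\<close>

lemma dual_cell_antimono:
  assumes "F face_of Q"
  shows "dual_cell p Q \<subseteq> dual_cell p F"
  using assms unfolding dual_cell_def by (auto simp: extreme_point_of_face)

section \<open>The cell spanned by the exponents that attain the maximum at a point\<close>

lemma inj_real_vec: "inj real_vec"
  by (auto simp: inj_def real_vec_def vec_eq_iff)

definition attained_hull :: "'n::finite trop_poly \<Rightarrow> real ^ 'n \<Rightarrow> (real ^ 'n) set" where
  "attained_hull p t = convex hull (real_vec ` {a. attains_max p t a})"

lemma trop_coeff_real:
  assumes "is_trop_poly p" and "a \<in> trop_supp p"
  shows "p a = ereal (real_of_ereal (p a))"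
  using assms by (cases "p a") (auto simp: is_trop_poly_def trop_supp_def)

lemma attains_max_iff:
  assumes "is_trop_poly p"
  shows "attains_max p t a \<longleftrightarrow> a \<in> trop_supp p \<and> (\<forall>b\<in>trop_supp p.
    real_of_ereal (p b) + real_vec b \<bullet> t \<le> real_of_ereal (p a) + real_vec a \<bullet> t)"
proof -
  have "trop_term p b t = ereal (real_of_ereal (p b) + real_vec b \<bullet> t)" if "b \<in> trop_supp p" for b
    unfolding trop_term_def by (subst trop_coeff_real[OF assms that]) simp
  then show ?thesis unfolding attains_max_def by auto
qed

lemma closed_attains_max:
  assumes "is_trop_poly p"
  shows "closed {t. attains_max p t a}"
  unfolding attains_max_iff[OF assms] Ball_def
  by (intro closed_Collect_conj closed_Collect_all closed_Collect_imp closed_Collect_le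
      continuous_intros) auto

lemma ex_attains_max:
  assumes "is_trop_poly p" and "trop_supp p \<noteq> {}"
  shows "\<exists>a. attains_max p t a"
proof -
  let ?h = "\<lambda>a. real_of_ereal (p a) + real_vec a \<bullet> t"
  have fin: "finite (?h ` trop_supp p)" using assms(1) by (simp add: is_trop_poly_def)
  then have "Max (?h ` trop_supp p) \<in> ?h ` trop_supp p" using assms(2) by (intro Max_in) auto
  then obtain a where "a \<in> trop_supp p" "?h a = Max (?h ` trop_supp p)" by auto
  then show ?thesis unfolding attains_max_iff[OF assms(1)] using fin by (auto intro!: exI[of _ a])
qed

text \<open>The functional \<open>(t, 1)\<close> sends a lifted point to the value at
  \<open>t\<close> of its term. Its supporting hyperplane at the maximal value \<open>M\<close> cuts
  out the lifted face over the attaining exponents.\<close>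

lemma attained_hull_in_dual_subdivision:
  assumes p: "is_trop_poly p" and "attains_max p t a0"
  shows "attained_hull p t \<in> dual_subdivision p"
proof -
  let ?S = "{(real_vec a, \<alpha>) | a \<alpha>. ereal \<alpha> \<le> p a}"
  let ?c = "\<lambda>a. real_of_ereal (p a)"
  define M where "M = ?c a0 + real_vec a0 \<bullet> t"
  let ?G = "convex hull ?S \<inter> {x. (t, 1) \<bullet> x = M}"
  have a0: "a0 \<in> trop_supp p" "\<And>b. b \<in> trop_supp p \<Longrightarrow> ?c b + real_vec b \<bullet> t \<le> M"
    using assms unfolding attains_max_iff[OF p] M_def by auto
  have supp: "a \<in> trop_supp p \<and> \<alpha> \<le> ?c a" if "ereal \<alpha> \<le> p a" for a \<alpha>
  proof -
    have "a \<in> trop_supp p" using that by (auto simp: trop_supp_def)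
    with trop_coeff_real[OF p this] that show ?thesis by (metis ereal_less_eq(3))
  qed
  have "?S \<subseteq> {x. (t, 1) \<bullet> x \<le> M}"
    using supp a0(2) by (force simp: inner_commute)
  then have "convex hull ?S \<subseteq> {x. (t, 1) \<bullet> x \<le> M}"
    by (intro hull_minimal convex_halfspace_le)
  then have face: "?G face_of (convex hull ?S)"
    by (intro face_of_Int_supporting_hyperplane_le) auto
  have attains: "attains_max p t a \<longleftrightarrow> a \<in> trop_supp p \<and> ?c a + real_vec a \<bullet> t = M" for a
    unfolding attains_max_iff[OF p] using a0 M_def by (metis order_antisym)
  \<comment> \<open>On the hyperplane only the tops of the vertical rays over attaining exponents
    survive: a lower point of a ray has value below \<open>M\<close>. There are finitely many tops,
    which makes the face bounded.\<close>
  have "?G \<inter> ?S = (\<lambda>a. (real_vec a, ?c a)) ` {a. attains_max p t a}" (is "_ = ?V")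
  proof (intro equalityI subsetI)
    fix x assume "x \<in> ?G \<inter> ?S"
    then obtain a \<alpha> where x: "x = (real_vec a, \<alpha>)" "ereal \<alpha> \<le> p a" "\<alpha> + real_vec a \<bullet> t = M"
      by (auto simp: inner_commute)
    then have "\<alpha> = ?c a" using supp[OF x(2)] a0(2)[of a] by auto
    then show "x \<in> ?V" using x supp[OF x(2)] attains by auto
  next
    fix x assume "x \<in> ?V"
    then obtain a where x: "x = (real_vec a, ?c a)" "a \<in> trop_supp p" "?c a + real_vec a \<bullet> t = M"
      using attains by auto
    moreover have "ereal (?c a) \<le> p a" using trop_coeff_real[OF p x(2)] by simp
    ultimately have "x \<in> ?S" by auto
    then show "x \<in> ?G \<inter> ?S" using x by (auto simp: inner_commute hull_inc)
  qed
  then have G: "?G = convex hull ?V" using face_of_convex_hull_eq[OF face] by simp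
  have "finite {a. attains_max p t a}"
    using p by (auto simp: is_trop_poly_def attains_max_def intro: finite_subset)
  then have "bounded ?G"
    unfolding G by (intro bounded_convex_hull finite_imp_bounded) auto
  moreover have "?G \<noteq> {}" unfolding G using assms(2) by auto
  moreover have "fst ` ?G = attained_hull p t"
    unfolding G attained_hull_def
    by (simp add: convex_hull_linear_image[OF linear_fst] image_image)
  ultimately show ?thesis
    using face unfolding dual_subdivision_def induced_subdivision_def by blast
qed

lemma mem_dual_cell_attained_hull: "t \<in> dual_cell p (attained_hull p t)"
  unfolding dual_cell_def attained_hull_def
  using extreme_point_of_convex_hull by (fastforce dest: injD[OF inj_real_vec])

text \<open>A cell is a polytope, hence the hull of its extreme points. These are exponents, and all
  of them attain the maximum at \<open>t\<close>.\<close>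

lemma dual_cell_imp_subset_attained_hull:
  assumes p: "is_trop_poly p" and Q: "Q \<in> dual_subdivision p" and t: "t \<in> dual_cell p Q"
  shows "Q \<subseteq> attained_hull p t"
proof -
  let ?S = "{(real_vec a, \<alpha>) | a \<alpha>. ereal \<alpha> \<le> p a}"
  obtain G where G: "Q = fst ` G" "G face_of (convex hull ?S)"
    using Q unfolding dual_subdivision_def induced_subdivision_def by blast
  define V where "V = fst ` (G \<inter> ?S)"
  have "Q = fst ` (convex hull (G \<inter> ?S))" using face_of_convex_hull_eq[OF G(2)] G(1) by simp
  then have hull: "Q = convex hull V"
    unfolding V_def by (simp add: convex_hull_linear_image[OF linear_fst])
  \<comment> \<open>The projection collapses each vertical ray to one exponent, so \<open>V\<close>
    is finite.\<close>
  have sub: "V \<subseteq> real_vec ` trop_supp p" by (auto simp: V_def trop_supp_def)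
  then have "finite V" using p by (auto simp: is_trop_poly_def intro: finite_subset)
  then have "compact Q" unfolding hull by (simp add: finite_imp_compact_convex_hull)
  then have "Q = convex hull {x. x extreme_point_of Q}"
    using hull by (intro Krein_Milman_Minkowski) auto
  moreover have "x \<in> real_vec ` {a. attains_max p t a}" if "x extreme_point_of Q" for x
  proof -
    have "x \<in> V" using that extreme_point_of_convex_hull unfolding hull by blast
    then obtain a where "x = real_vec a" using sub by auto
    then show ?thesis using that t unfolding dual_cell_def by auto
  qed
  ultimately show ?thesis unfolding attained_hull_def by (metis hull_mono mem_Collect_eq subsetI)
qed

section \<open>Connectedness of the union of the cells that meet a connected set\<close>

lemma connected_UN_convex_hull_closed_cover:
  fixes R :: "'a::topological_space set" and x :: "'i \<Rightarrow> 'b::real_normed_vector"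
  assumes "finite I" and closed: "\<And>i. i \<in> I \<Longrightarrow> closed (T i)"
    and "connected R" and cover: "R \<subseteq> (\<Union>i\<in>I. T i)"
  shows "connected (\<Union>t\<in>R. convex hull (x ` {i\<in>I. t \<in> T i}))" (is "connected (\<Union>t\<in>R. ?Q t)")
proof (rule connectedI)
  let ?U = "\<Union>t\<in>R. ?Q t"
  fix A B assume AB: "open A" "open B" "A \<inter> ?U \<noteq> {}" "B \<inter> ?U \<noteq> {}" "A \<inter> B \<inter> ?U = {}" "?U \<subseteq> A \<union> B"
  \<comment> \<open>\<open>?E A\<close> is the union of the closed sets \<open>T i\<close> whose
    vertex \<open>x i\<close> lies in \<open>A\<close>; a separation of the union by
    \<open>A\<close> and \<open>B\<close> makes \<open>?E A\<close> and \<open>?E B\<close> separate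
    \<open>R\<close>.\<close>
  let ?E = "\<lambda>A. \<Union>i\<in>{i\<in>I. x i \<in> A}. T i"
  \<comment> \<open>Each hull is convex, so it cannot meet both sides.\<close>
  have sep: False if "t \<in> R" "y \<in> ?Q t" "z \<in> ?Q t" "y \<in> A" "z \<in> B" for t y z
  proof -
    have "connected (?Q t)" by (intro convex_connected convex_convex_hull)
    moreover have "?Q t \<subseteq> A \<union> B" "A \<inter> B \<inter> ?Q t = {}" using AB(5,6) \<open>t \<in> R\<close> by blast+
    ultimately show False using connectedD[OF _ AB(1,2)] that by blast
  qed
  have vertex: "x i \<in> ?Q t" if "i \<in> I" "t \<in> T i" for i t using that by (auto intro: hull_inc)
  have AorB: "x i \<in> A \<or> x i \<in> B" if "i \<in> I" "t \<in> T i" "t \<in> R" for i t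
    using vertex[OF that(1,2)] that(3) AB(6) by blast
  have "closed (?E A)" "closed (?E B)" using \<open>finite I\<close> closed by (auto intro!: closed_UN)
  moreover have "R \<subseteq> ?E A \<union> ?E B" using cover AorB by blast
  moreover have "?E A \<inter> ?E B \<inter> R = {}" using sep vertex by blast
  moreover have "?E A \<inter> R \<noteq> {}"
  proof -
    \<comment> \<open>The point \<open>y\<close> of the hull need not be a vertex; but some vertex
      of the same hull exists by the cover, and \<open>sep\<close> keeps it on the side of
      \<open>y\<close>.\<close>
    obtain t y where "t \<in> R" "y \<in> ?Q t" "y \<in> A" using AB(3) by blast
    moreover obtain i where "i \<in> I" "t \<in> T i" using cover \<open>t \<in> R\<close> by blast
    ultimately show ?thesis using AorB sep vertex by blast
  qed
  moreover have "?E B \<inter> R \<noteq> {}"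
  proof -
    obtain t y where "t \<in> R" "y \<in> ?Q t" "y \<in> B" using AB(4) by blast
    moreover obtain i where "i \<in> I" "t \<in> T i" using cover \<open>t \<in> R\<close> by blast
    ultimately show ?thesis using AorB sep vertex by blast
  qed
  ultimately show False using \<open>connected R\<close> unfolding connected_closed by blast
qed

lemma connected_Union_dual_cells_meeting:
  assumes p: "is_trop_poly p" and "connected R"
  shows "connected (\<Union> {Q \<in> dual_subdivision p. dual_cell p Q \<inter> R \<noteq> {}})" (is "connected ?U")
proof -
  have "?U = (\<Union>t\<in>R. attained_hull p t)"
  proof (intro equalityI subsetI)
    fix y assume "y \<in> ?U"
    then obtain Q t where "y \<in> Q" "Q \<in> dual_subdivision p" "t \<in> dual_cell p Q" "t \<in> R" by blast
    then show "y \<in> (\<Union>t\<in>R. attained_hull p t)"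
      using dual_cell_imp_subset_attained_hull[OF p] by blast
  next
    fix y assume "y \<in> (\<Union>t\<in>R. attained_hull p t)"
    then obtain t where t: "t \<in> R" "y \<in> attained_hull p t" by blast
    \<comment> \<open>A nonempty hull has a generator, as needed for the hull to be a cell.\<close>
    then obtain a where "attains_max p t a" unfolding attained_hull_def
      by (cases "{a. attains_max p t a} = {}") auto
    then show "y \<in> ?U"
      using t attained_hull_in_dual_subdivision[OF p] mem_dual_cell_attained_hull by blast
  qed
  moreover have "connected (\<Union>t\<in>R. attained_hull p t)"
  proof (cases "trop_supp p = {}")
    \<comment> \<open>For \<open>p = -\<infinity>\<close> no exponent covers \<open>R\<close>, but
      all hulls are empty.\<close>
    case True
    then show ?thesis by (simp add: attained_hull_def attains_max_def)
  next
    case False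
    have "connected (\<Union>t\<in>R. convex hull
        (real_vec ` {a \<in> trop_supp p. t \<in> {t. attains_max p t a}}))"
    proof (rule connected_UN_convex_hull_closed_cover)
      show "R \<subseteq> (\<Union>a\<in>trop_supp p. {t. attains_max p t a})"
        using ex_attains_max[OF p False] by (auto simp: attains_max_def)
    qed (use p closed_attains_max \<open>connected R\<close> in \<open>auto simp: is_trop_poly_def\<close>)
    moreover have "{a \<in> trop_supp p. t \<in> {t. attains_max p t a}} = {a. attains_max p t a}" for t
      by (auto simp: attains_max_def)
    ultimately show ?thesis unfolding attained_hull_def by simp
  qed
  ultimately show ?thesis by simp
qed

lemma is_trop_poly_restrict_z0:
  assumes "is_trop_poly g"
  shows "is_trop_poly (restrict_z0 m g)"
  unfolding is_trop_poly_def
proof (intro conjI allI)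
  \<comment> \<open>The degree bound places the support in the image of a finite box.\<close>
  have "a \<in> (\<lambda>(i, j). vector [i, j]) ` ({..m} \<times> {..m})" if "a \<in> trop_supp (restrict_z0 m g)" for a
  proof
    show "a = (case (a $ 1, a $ 2) of (i, j) \<Rightarrow> vector [i, j])" by (simp add: vec_eq_iff forall_2)
    have "a $ 1 + a $ 2 \<le> m" using that by (auto simp: trop_supp_def restrict_z0_def split: if_splits)
    then show "(a $ 1, a $ 2) \<in> {..m} \<times> {..m}" by auto
  qed
  then show "finite (trop_supp (restrict_z0 m g))"
    by (meson finite_SigmaI finite_atMost finite_imageI finite_subset subsetI)
next
  fix a :: "nat ^ 2"
  let ?A = "(\<lambda>c. g (vector [a $ 1, a $ 2, c])) ` {0..m - a $ 1 - a $ 2}"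
  have "Max ?A \<in> ?A" by (intro Max_in) auto
  then have "Max ?A \<noteq> \<infinity>" using assms unfolding is_trop_poly_def by (metis imageE)
  then show "restrict_z0 m g a \<noteq> \<infinity>" by (simp add: restrict_z0_def)
qed

theorem lemma4p8:
  fixes m :: nat and g :: "3 trop_poly" and C :: "(real ^ 3) set"
  assumes "is_trop_poly g"
    and "\<forall>a\<in>trop_supp g. a $ 1 + a $ 2 + a $ 3 \<le> m"
    and "newton_polytope g =
           convex hull {0, axis 1 (real m), axis 2 (real m), axis 3 (real m)}"
    and "smooth_complete_intersection_curve trop_plane g C"
  shows "(\<forall>Q F. marked_cell (restrict_z0 m g) Q \<and> F face_of Q \<and> F \<noteq> {}
            \<longrightarrow> marked_cell (restrict_z0 m g) F) \<and>
         connected (\<Union> {Q. marked_cell (restrict_z0 m g) Q})"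
proof (intro conjI allI impI)
  fix Q F assume "marked_cell (restrict_z0 m g) Q \<and> F face_of Q \<and> F \<noteq> {}"
  \<comment> \<open>The point of the quadrant that marks \<open>Q\<close> also marks
    \<open>F\<close>.\<close>
  then show "marked_cell (restrict_z0 m g) F"
    using induced_subdivision_face dual_cell_antimono
    unfolding marked_cell_def dual_subdivision_def by blast
next
  have "convex {t :: real ^ 2. t $ 1 \<le> 0 \<and> t $ 2 \<le> 0}"
    by (rule convexI) (auto intro!: add_nonpos_nonpos mult_nonneg_nonpos)
  then have "connected {t :: real ^ 2. t $ 1 \<le> 0 \<and> t $ 2 \<le> 0}"
    by (rule convex_connected)
  then show "connected (\<Union> {Q. marked_cell (restrict_z0 m g) Q})"
    unfolding marked_cell_def
    by (rule connected_Union_dual_cells_meeting[OF is_trop_poly_restrict_z0[OF assms(1)]])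
qed

end
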